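(* Let $h:[0,1]\to[0,1]$ and let $\epsilon>0$. If there exists $0<q<1$ such that $h(q)\le\epsilon\, Ent(q)$, then (for all sufficiently large $n$) there exists a function $f:[0,1]^n\to\{0,1\}$ such that $\mathbb{E}f=\Theta(1)$, and for all $1\le k\le n$ the $h$-influence of the $k$-th variable on $f$ satisfies $$I_f^h(k)\ \le\ c\,\epsilon\,\frac{\log n}{n},$$ where $c$ is a universal constant.
   Context: $[0,1]^n$ carries the Lebesgue measure, and expectations are with respect to it. $\log$ is the logarithm to base 2. $Ent(t)=-t\log t-(1-t)\log(1-t)$ is the entropy function. The notation $\mathbb{E}f=\Theta(1)$ is asymptotic in $n$: $\mathbb{E}f$ is of constant order as $n$ grows (in the construction, $\mathbb{E}f$ stays bounded away from 0 and 1). For $f:[0,1]^n\to\{0,1\}$, $x\in[0,1]^n$ and $1\le k\le n$, let $f_k^x:[0,1]\to\{0,1\}$ be the restriction of $f$ to the fiber through $x$ in direction $k$: $f_k^x(t)=f(x_1,\ldots,x_{k-1},t,x_{k+1},\ldots,x_n)$. For $h:[0,1]\to[0,1]$, the $h$-influence of the $k$-th coordinate on $f$ is $I_f^h(k)=\mathbb{E}_{x\in[0,1]^n}\,h(\mathbb{E}f_k^x)$, where $\mathbb{E}f_k^x=\int_0^1 f_k^x(t)\,dt$.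
   Formalization: The formal statement adds the assumption h(0)=h(1)=0; without it the claim fails, e.g. for h≡1, ε=1, q=1/2, where every h-influence equals 1 and exceeds c·log n/n for large n. *)

theory Defs
  imports "HOL-Probability.Probability" "HOL-Library.Landau_Symbols"
begin

definition unit_interval :: "real measure" where
  "unit_interval = restrict_space lborel {0..1}"

text \<open>Coordinates are indexed by \<open>{1..n}\<close>; points are functions that are \<open>undefined\<close> outside
  this index set.\<close>

definition cube :: "nat \<Rightarrow> (nat \<Rightarrow> real) measure" where
  "cube n = (\<Pi>\<^sub>M i\<in>{1..n}. unit_interval)"

text \<open>Since \<open>log 2 0 = 0\<close>, the convention \<open>0 log 0 = 0\<close> holds, so \<open>Ent 0 = Ent 1 = 0\<close>.\<close>

definition Ent :: "real \<Rightarrow> real" where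
  "Ent t = - t * log 2 t - (1 - t) * log 2 (1 - t)"

definition boolean_on_cube :: "nat \<Rightarrow> ((nat \<Rightarrow> real) \<Rightarrow> real) \<Rightarrow> bool" where
  "boolean_on_cube n f \<longleftrightarrow> f \<in> borel_measurable (cube n) \<and> f \<in> space (cube n) \<rightarrow> {0, 1}"

definition mean :: "nat \<Rightarrow> ((nat \<Rightarrow> real) \<Rightarrow> real) \<Rightarrow> real" where
  "mean n f = (\<integral>x. f x \<partial>cube n)"

definition fiber :: "((nat \<Rightarrow> real) \<Rightarrow> real) \<Rightarrow> nat \<Rightarrow> (nat \<Rightarrow> real) \<Rightarrow> real \<Rightarrow> real" where
  "fiber f k x = (\<lambda>t. f (x(k := t)))"

definition fiber_mean :: "((nat \<Rightarrow> real) \<Rightarrow> real) \<Rightarrow> nat \<Rightarrow> (nat \<Rightarrow> real) \<Rightarrow> real" where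
  "fiber_mean f k x = (\<integral>t. fiber f k x t \<partial>unit_interval)"

text \<open>The Bochner integral of a non-integrable function is \<open>0\<close>. As \<open>h\<close> need not be measurable,
  \<open>h_influence\<close> carries its intended meaning only together with \<open>h_influence_defined\<close>.\<close>

definition h_influence_defined ::
  "(real \<Rightarrow> real) \<Rightarrow> nat \<Rightarrow> ((nat \<Rightarrow> real) \<Rightarrow> real) \<Rightarrow> nat \<Rightarrow> bool" where
  "h_influence_defined h n f k \<longleftrightarrow> integrable (cube n) (\<lambda>x. h (fiber_mean f k x))"

definition h_influence ::
  "(real \<Rightarrow> real) \<Rightarrow> nat \<Rightarrow> ((nat \<Rightarrow> real) \<Rightarrow> real) \<Rightarrow> nat \<Rightarrow> real" where
  "h_influence h n f k = (\<integral>x. h (fiber_mean f k x) \<partial>cube n)"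

end

theory Submission
  imports Defs "HOL-Real_Asymp.Real_Asymp"
begin

text \<open>
  The function is a biased version of the tribes function of Ben-Or and Linial. Suppose first that
  \<open>q \<le> 1/2\<close>. Split the coordinates into \<open>n div m\<close> disjoint tribes of size \<open>m\<close>, leaving at most
  \<open>m - 1\<close> coordinates unused, and let \<open>f x = 1\<close> iff some tribe is satisfied, that is, all its
  coordinates are at most \<open>q\<close>. A fiber of \<open>f\<close> is constant or the indicator of \<open>[0, q]\<close>, so its mean
  is \<open>0\<close>, \<open>1\<close> or \<open>q\<close> (\<open>fiber_mean_tribes\<close>). Since \<open>h 0 = h 1 = 0\<close>, the influence of \<open>k\<close> is \<open>h q\<close>
  times the probability that the fiber is non-constant, and this requires the other \<open>m - 1\<close>
  members of the tribe of \<open>k\<close> to be at most \<open>q\<close>. Hence the influence is at most \<open>h q * q ^ (m - 1)\<close>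
  (\<open>h_influence_le\<close>, \<open>fibers_block_tribes\<close>).

  Take \<open>m\<close> least with \<open>q ^ m \<le> m / (2 n)\<close>; then \<open>m\<close> is at most \<open>4 log n / log (1/q)\<close>
  (\<open>tribe_size\<close>), and \<open>q ^ (m - 1) \<le> m / (2 n q)\<close> bounds the influence by
  \<open>2 h q log n / (n q log (1/q))\<close>. Because \<open>Ent q \<le> 3 q log (1/q)\<close> for \<open>q \<le> 1/2\<close> (\<open>Ent_le\<close>), the
  assumption \<open>h q \<le> \<epsilon> Ent q\<close> turns this into \<open>6 \<epsilon> log n / n\<close>.

  Tribes are independent, so the mean of \<open>f\<close> is \<open>1 - (1 - q ^ m) ^ (n div m)\<close>. The expected number of
  satisfied tribes lies between \<open>q/8\<close> and \<open>1/2\<close>, and so the mean lies between \<open>1 - exp (- q/8)\<close> and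
  \<open>1/2\<close> (\<open>mean_block_tribes_bounds\<close>). The lower bound depends on \<open>q\<close>, because rounding \<open>m\<close> to an
  integer can change \<open>q ^ m\<close> by a factor \<open>q\<close>, but not on \<open>n\<close>.

  If \<open>q > 1/2\<close>, use the complement of the tribes function for \<open>1 - q\<close>: its non-constant fibers have
  mean \<open>q\<close>, and \<open>Ent\<close> is symmetric about \<open>1/2\<close>.
\<close>

section \<open>Events in the cube\<close>

lemma space_unit_interval: "space unit_interval = {0..1}"
  by (simp add: unit_interval_def space_restrict_space)

lemma prob_space_unit_interval: "prob_space unit_interval"
  by (rule prob_spaceI)
    (simp add: unit_interval_def space_restrict_space emeasure_restrict_space)

lemma atMost_in_unit_interval: "0 \<le> q \<Longrightarrow> q \<le> 1 \<Longrightarrow> {0..q} \<in> sets unit_interval"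
  by (auto simp: unit_interval_def sets_restrict_space intro!: image_eqI[where x="{0..q}"])

lemma emeasure_unit_interval_atMost:
  assumes "0 \<le> q" "q \<le> 1"
  shows "emeasure unit_interval {0..q} = ennreal q"
  using assms by (simp add: unit_interval_def emeasure_restrict_space)

lemma measurable_unit_interval_borel: "(\<lambda>t. t) \<in> borel_measurable unit_interval"
  unfolding unit_interval_def by (intro measurable_restrict_space1) simp

lemma product_prob_space_unit_interval: "product_prob_space (\<lambda>_. unit_interval)"
  by (simp add: product_prob_spaceI prob_space_unit_interval)

lemma prob_space_cube: "prob_space (cube n)"
  unfolding cube_def by (rule prob_space_PiM) (rule prob_space_unit_interval)

lemma space_cube: "space (cube n) = {1..n} \<rightarrow>\<^sub>E {0..1}"
  by (simp add: cube_def space_PiM space_unit_interval)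

lemma coordinate_borel_measurable:
  "i \<in> S \<Longrightarrow> (\<lambda>x. x i) \<in> borel_measurable (\<Pi>\<^sub>M i\<in>S. unit_interval)"
  by (rule measurable_compose[where N=unit_interval and g="\<lambda>t. t"])
    (rule measurable_component_singleton, assumption, rule measurable_unit_interval_borel)

lemma sets_all_coordinates_le:
  assumes "finite S" "S \<subseteq> R"
  shows "{x \<in> space (\<Pi>\<^sub>M i\<in>R. unit_interval). \<forall>i\<in>S. x i \<le> q} \<in> sets (\<Pi>\<^sub>M i\<in>R. unit_interval)"
proof (rule sets.sets_Collect_finite_All)
  fix i assume "i \<in> S"
  then have [measurable]: "(\<lambda>x. x i) \<in> borel_measurable (\<Pi>\<^sub>M i\<in>R. unit_interval)"
    using assms by (intro coordinate_borel_measurable) auto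
  show "{x \<in> space (\<Pi>\<^sub>M i\<in>R. unit_interval). x i \<le> q} \<in> sets (\<Pi>\<^sub>M i\<in>R. unit_interval)"
    by measurable
qed (use assms in auto)

lemma prob_all_coordinates_le:
  assumes "S \<subseteq> {1..n}" "0 \<le> q" "q \<le> 1"
  shows "measure (cube n) {x \<in> space (cube n). \<forall>i\<in>S. x i \<le> q} = q ^ card S"
proof -
  interpret product_prob_space "\<lambda>_. unit_interval" "{1..n}"
    by (rule product_prob_space_unit_interval)
  have fin: "finite S" using assms(1) finite_subset by blast
  have "{x \<in> space (cube n). \<forall>i\<in>S. x i \<le> q} = {x \<in> space (cube n). \<forall>i\<in>S. x i \<in> {0..q}}"
    using assms(1) by (fastforce simp: space_cube PiE_iff)
  moreover have "emeasure (cube n) {x \<in> space (cube n). \<forall>i\<in>S. x i \<in> {0..q}} = ennreal (q ^ card S)"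
    using emeasure_PiM_Collect[of S "\<lambda>_. {0..q}"] assms fin
    by (simp add: cube_def atMost_in_unit_interval emeasure_unit_interval_atMost ennreal_power)
  ultimately show ?thesis
    using assms by (simp add: measure_def)
qed

lemma indep_vars_coordinates:
  assumes "n \<ge> 1"
  shows "prob_space.indep_vars (cube n) (\<lambda>_. unit_interval) (\<lambda>i x. x i) {1..n}"
proof -
  interpret P: product_prob_space "\<lambda>_. unit_interval" "{1..n}"
    by (rule product_prob_space_unit_interval)
  let ?P = "\<Pi>\<^sub>M i\<in>{1..n}. unit_interval"
  have "distr ?P ?P (\<lambda>x. \<lambda>i\<in>{1..n}. x i) = distr ?P ?P (\<lambda>x. x)"
    by (rule distr_cong) (auto simp: space_PiM)
  also have "\<dots> = (\<Pi>\<^sub>M i\<in>{1..n}. distr ?P unit_interval (\<lambda>x. x i))"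
    unfolding distr_id by (rule PiM_cong[OF refl]) (rule P.PiM_component[symmetric])
  finally show ?thesis
    unfolding cube_def using assms
    by (subst P.P.indep_vars_iff_distr_eq_PiM') (auto intro: measurable_component_singleton)
qed

text \<open>Events that depend on disjoint blocks of coordinates are independent, so the probability
  that no block lies entirely below \<open>q\<close> factors.\<close>

lemma prob_no_block_le:
  assumes "n \<ge> 1" "finite J" "J \<noteq> {}" "disjoint_family_on T J"
    and T: "\<And>j. j \<in> J \<Longrightarrow> T j \<subseteq> {1..n}" and q: "0 \<le> q" "q \<le> 1"
  shows "measure (cube n) {x \<in> space (cube n). \<forall>j\<in>J. \<not> (\<forall>i\<in>T j. x i \<le> q)}
    = (\<Prod>j\<in>J. 1 - q ^ card (T j))"
proof -
  interpret prob_space "cube n" by (rule prob_space_cube)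
  let ?X = "\<lambda>j x. restrict x (T j)"
  let ?P = "\<lambda>j. \<Pi>\<^sub>M i\<in>T j. unit_interval"
  let ?A = "\<lambda>j. space (?P j) - {y \<in> space (?P j). \<forall>i\<in>T j. y i \<le> q}"
  have ind: "indep_vars ?P ?X J"
    using indep_vars_restrict[OF indep_vars_coordinates[OF assms(1)] T assms(4)] by simp
  have fin: "finite (T j)" if "j \<in> J" for j
    using T[OF that] finite_subset by blast
  have A: "?A j \<in> sets (?P j)" if "j \<in> J" for j
    by (intro sets.Diff sets.top sets_all_coordinates_le fin[OF that]) auto
  have X: "?X j -` ?A j \<inter> space (cube n) = space (cube n) - {x \<in> space (cube n). \<forall>i\<in>T j. x i \<le> q}"
    if "j \<in> J" for j
  proof -
    have "restrict x (T j) \<in> space (?P j)" if "x \<in> space (cube n)" for x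
      using T[OF \<open>j \<in> J\<close>] that
      by (fastforce simp: space_PiM space_cube space_unit_interval PiE_iff)
    then show ?thesis by auto
  qed
  have "measure (cube n) {x \<in> space (cube n). \<forall>j\<in>J. \<not> (\<forall>i\<in>T j. x i \<le> q)}
      = prob (\<Inter>j\<in>J. ?X j -` ?A j \<inter> space (cube n))"
    using X assms(3) by (intro arg_cong[where f="measure (cube n)"]) auto
  also have "\<dots> = (\<Prod>j\<in>J. prob (?X j -` ?A j \<inter> space (cube n)))"
    using indep_varsD[OF ind assms(3,2) order_refl A] by simp
  also have "\<dots> = (\<Prod>j\<in>J. 1 - q ^ card (T j))"
  proof (rule prod.cong[OF refl])
    fix j assume j: "j \<in> J"
    have "{x \<in> space (cube n). \<forall>i\<in>T j. x i \<le> q} \<in> events"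
      unfolding cube_def by (rule sets_all_coordinates_le[OF fin[OF j] T[OF j]])
    then show "prob (?X j -` ?A j \<inter> space (cube n)) = 1 - q ^ card (T j)"
      unfolding X[OF j] by (simp add: prob_compl prob_all_coordinates_le[OF T[OF j] q])
  qed
  finally show ?thesis .
qed

section \<open>Tribes functions and their fibers\<close>

definition tribes :: "nat set \<Rightarrow> (nat \<Rightarrow> nat set) \<Rightarrow> real \<Rightarrow> (nat \<Rightarrow> real) \<Rightarrow> real" where
  "tribes J T q x = of_bool (\<exists>j\<in>J. \<forall>i\<in>T j. x i \<le> q)"

lemma boolean_tribes:
  assumes "finite J" "\<And>j. j \<in> J \<Longrightarrow> T j \<subseteq> {1..n}"
  shows "boolean_on_cube n (tribes J T q)"
proof -
  have "{x \<in> space (cube n). \<exists>j\<in>J. \<forall>i\<in>T j. x i \<le> q} \<in> sets (cube n)"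
  proof (rule sets.sets_Collect_finite_Ex[OF _ assms(1)])
    fix j assume "j \<in> J"
    then show "{x \<in> space (cube n). \<forall>i\<in>T j. x i \<le> q} \<in> sets (cube n)"
      unfolding cube_def using assms(2) finite_subset[of "T j" "{1..n}"]
      by (intro sets_all_coordinates_le) auto
  qed
  then have "Measurable.pred (cube n) (\<lambda>x. \<exists>j\<in>J. \<forall>i\<in>T j. x i \<le> q)"
    by (simp add: pred_def)
  then show ?thesis
    unfolding boolean_on_cube_def tribes_def by auto
qed

lemma integral_unit_interval_step:
  assumes "0 \<le> q" "q \<le> 1"
  shows "(\<integral>t. of_bool (t \<le> q) \<partial>unit_interval) = q"
proof -
  have "(\<integral>t. of_bool (t \<le> q) \<partial>unit_interval) = (\<integral>t. indicator {0..q} t \<partial>unit_interval)"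
    by (rule Bochner_Integration.integral_cong) (auto simp: space_unit_interval indicator_def)
  also have "\<dots> = q"
    using assms by (simp add: measure_def emeasure_unit_interval_atMost atMost_in_unit_interval
        sets.Int_space_eq1)
  finally show ?thesis .
qed

text \<open>A tribe without \<open>k\<close> that is satisfied makes the fiber constant \<open>1\<close>. Otherwise only a tribe
  containing \<open>k\<close> can be satisfied: if the other members of one such tribe are all at most \<open>q\<close>, the fiber
  is the step function at \<open>q\<close>, and if there is none, it is constant \<open>0\<close>.\<close>

lemma fiber_mean_tribes:
  assumes q: "0 \<le> q" "q \<le> 1"
  shows "fiber_mean (tribes J T q) k x \<in> {0, 1} \<or>
    fiber_mean (tribes J T q) k x = q \<and> (\<exists>j\<in>J. k \<in> T j \<and> (\<forall>i\<in>T j - {k}. x i \<le> q))"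
proof -
  interpret prob_space unit_interval by (rule prob_space_unit_interval)
  let ?sat = "\<exists>j\<in>J. k \<notin> T j \<and> (\<forall>i\<in>T j. x i \<le> q)"
  let ?open = "\<exists>j\<in>J. k \<in> T j \<and> (\<forall>i\<in>T j - {k}. x i \<le> q)"
  have *: "(\<exists>j\<in>J. \<forall>i\<in>T j. (x(k := t)) i \<le> q) \<longleftrightarrow> ?sat \<or> (?open \<and> t \<le> q)" (is "?L \<longleftrightarrow> ?R") for t
  proof
    assume ?L
    then obtain j where j: "j \<in> J" "\<forall>i\<in>T j. (x(k := t)) i \<le> q" by blast
    show ?R
    proof (cases "k \<in> T j")
      case True
      then have "t \<le> q" "\<forall>i\<in>T j - {k}. x i \<le> q" using j(2) by (auto split: if_splits)
      then show ?thesis using j(1) True by blast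
    next
      case False
      then have "\<forall>i\<in>T j. x i \<le> q" using j(2) by (metis fun_upd_other)
      then show ?thesis using j(1) False by blast
    qed
  next
    assume ?R
    then show ?L
    proof
      assume ?sat
      then show ?L by (metis fun_upd_other)
    next
      assume "?open \<and> t \<le> q"
      then show ?L by (metis Diff_iff fun_upd_apply insert_iff empty_iff)
    qed
  qed
  have "fiber_mean (tribes J T q) k x = (\<integral>t. of_bool (?sat \<or> (?open \<and> t \<le> q)) \<partial>unit_interval)"
    unfolding fiber_mean_def fiber_def tribes_def * ..
  also have "\<dots> = (if ?sat then 1 else if ?open then q else 0)"
    using integral_unit_interval_step[OF q] prob_space
    by (cases ?sat; cases ?open) (simp_all only: simp_thms of_bool_eq if_True if_False
        Bochner_Integration.integral_zero lebesgue_integral_const scaleR_one)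
  finally show ?thesis by (metis insertCI)
qed

section \<open>Influences of functions with a three-valued fiber mean\<close>

lemma fiber_mean_measurable:
  assumes "boolean_on_cube n f" "k \<in> {1..n}"
  shows "(\<lambda>x. fiber_mean f k x) \<in> borel_measurable (cube n)"
proof -
  interpret U: prob_space unit_interval by (rule prob_space_unit_interval)
  have f: "f \<in> borel_measurable (cube n)"
    using assms(1) by (simp add: boolean_on_cube_def)
  have "(\<lambda>p. (fst p)(k := snd p)) \<in> measurable (cube n \<Otimes>\<^sub>M unit_interval) (cube n)"
    unfolding cube_def using assms(2)
    by (intro measurable_fun_upd[where J="{1..n}"]) auto
  then have "(\<lambda>p. f ((fst p)(k := snd p))) \<in> borel_measurable (cube n \<Otimes>\<^sub>M unit_interval)"
    by (rule measurable_compose[OF _ f])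
  then show ?thesis
    unfolding fiber_mean_def fiber_def
    by (intro U.borel_measurable_lebesgue_integral) (simp add: case_prod_beta')
qed

text \<open>Since \<open>h\<close> vanishes at \<open>0\<close> and \<open>1\<close>, its composition with the fiber mean is \<open>h q\<close> times the
  indicator of the event that the fiber mean is neither \<open>0\<close> nor \<open>1\<close>. That event is measurable and
  contained in \<open>B\<close>, which gives integrability for an arbitrary \<open>h\<close> as well as the bound.\<close>

lemma h_influence_le:
  assumes f: "boolean_on_cube n f" and k: "k \<in> {1..n}"
    and B: "B \<in> sets (cube n)" "measure (cube n) B \<le> p"
    and fib: "\<And>x. x \<in> space (cube n) \<Longrightarrow>
      fiber_mean f k x \<in> {0, 1} \<or> fiber_mean f k x = q \<and> x \<in> B"
    and h: "h 0 = 0" "h 1 = 0" "0 \<le> h q"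
  shows "h_influence_defined h n f k" and "h_influence h n f k \<le> h q * p"
proof -
  interpret prob_space "cube n" by (rule prob_space_cube)
  let ?D = "{x \<in> space (cube n). fiber_mean f k x \<notin> {0, 1}}"
  note [measurable] = fiber_mean_measurable[OF f k]
  have D: "?D \<in> sets (cube n)" by measurable
  have eq: "h (fiber_mean f k x) = h q * indicator ?D x" if "x \<in> space (cube n)" for x
    using fib[OF that] that h by (auto simp: indicator_def)
  have "integrable (cube n) (\<lambda>x. h q * indicator ?D x)"
    using D by (intro integrable_mult_right integrable_real_indicator) (auto simp: emeasure_eq_measure)
  then show "h_influence_defined h n f k"
    unfolding h_influence_defined_def
    by (subst Bochner_Integration.integrable_cong[OF refl eq])
  have "h_influence h n f k = (\<integral>x. h q * indicator ?D x \<partial>cube n)"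
    unfolding h_influence_def by (rule Bochner_Integration.integral_cong[OF refl eq])
  also have "\<dots> = h q * prob ?D"
    using D by (simp add: sets.Int_space_eq1)
  also have "\<dots> \<le> h q * p"
  proof (rule mult_left_mono[OF _ h(3)])
    have "?D \<subseteq> B" using fib by auto
    then show "prob ?D \<le> p" by (rule order_trans[OF finite_measure_mono[OF _ B(1)] B(2)])
  qed
  finally show "h_influence h n f k \<le> h q * p" .
qed

lemma
  assumes "boolean_on_cube n f"
  shows boolean_compl: "boolean_on_cube n (\<lambda>x. 1 - f x)"
    and mean_compl: "mean n (\<lambda>x. 1 - f x) = 1 - mean n f"
proof -
  interpret prob_space "cube n" by (rule prob_space_cube)
  show "boolean_on_cube n (\<lambda>x. 1 - f x)"
    using assms by (auto simp: boolean_on_cube_def Pi_iff)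
  have "integrable (cube n) f"
    using assms by (intro integrable_const_bound[where B=1] AE_I2)
      (auto simp: boolean_on_cube_def Pi_iff)
  then show "mean n (\<lambda>x. 1 - f x) = 1 - mean n f"
    unfolding mean_def by (simp add: prob_space)
qed

lemma fiber_mean_compl:
  assumes f: "boolean_on_cube n f" and k: "k \<in> {1..n}" and x: "x \<in> space (cube n)"
  shows "fiber_mean (\<lambda>x. 1 - f x) k x = 1 - fiber_mean f k x"
proof -
  interpret U: prob_space unit_interval by (rule prob_space_unit_interval)
  have fm: "f \<in> borel_measurable (cube n)"
    using f by (simp add: boolean_on_cube_def)
  have upd: "(\<lambda>t. x(k := t)) \<in> measurable unit_interval (cube n)"
    unfolding cube_def using k x
    by (intro measurable_fun_upd[where J="{1..n}"]) (auto simp: cube_def)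
  have "integrable unit_interval (\<lambda>t. f (x(k := t)))"
  proof (intro U.integrable_const_bound[where B=1] AE_I2)
    show "(\<lambda>t. f (x(k := t))) \<in> borel_measurable unit_interval"
      by (rule measurable_compose[OF upd fm])
    fix t assume "t \<in> space unit_interval"
    then have "f (x(k := t)) \<in> {0, 1}"
      using f measurable_space[OF upd] unfolding boolean_on_cube_def by blast
    then show "norm (f (x(k := t))) \<le> 1" by auto
  qed
  then show ?thesis
    unfolding fiber_mean_def fiber_def by (simp add: U.prob_space)
qed

section \<open>Tribes of equal size\<close>

definition block :: "nat \<Rightarrow> nat \<Rightarrow> nat set" where
  "block m j = {j * m + 1..j * m + m}"

lemma card_block: "card (block m j) = m"
  by (simp add: block_def)

lemma block_unique:
  assumes "i \<in> block m j"
  shows "j = (i - 1) div m"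
proof -
  have "m * j \<le> i - 1" "i - 1 < m * Suc j"
    using assms by (auto simp: block_def mult.commute)
  then show ?thesis by (rule div_nat_eqI[symmetric])
qed

lemma disjoint_blocks: "disjoint_family_on (block m) J"
  unfolding disjoint_family_on_def using block_unique by blast

lemma block_subset:
  assumes "j < n div m"
  shows "block m j \<subseteq> {1..n}"
proof -
  have "Suc j * m \<le> (n div m) * m"
    using assms by (intro mult_le_mono1) simp
  also have "\<dots> \<le> n" by simp
  finally show ?thesis by (auto simp: block_def)
qed

abbreviation block_tribes :: "nat \<Rightarrow> nat \<Rightarrow> real \<Rightarrow> (nat \<Rightarrow> real) \<Rightarrow> real" where
  "block_tribes n m \<equiv> tribes {..<n div m} (block m)"

lemma mean_block_tribes:
  assumes "1 \<le> m" "m \<le> n" "0 \<le> q" "q \<le> 1"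
  shows "mean n (block_tribes n m q) = 1 - (1 - q ^ m) ^ (n div m)"
proof -
  interpret prob_space "cube n" by (rule prob_space_cube)
  let ?f = "block_tribes n m q"
  let ?Z = "{x \<in> space (cube n). \<forall>j\<in>{..<n div m}. \<not> (\<forall>i\<in>block m j. x i \<le> q)}"
  have bf: "boolean_on_cube n ?f"
    using block_subset by (intro boolean_tribes) auto
  have "?Z = {x \<in> space (cube n). ?f x = 0}"
    by (auto simp: tribes_def)
  also have "\<dots> \<in> events"
  proof -
    have [measurable]: "?f \<in> borel_measurable (cube n)"
      using bf by (simp add: boolean_on_cube_def)
    show ?thesis by measurable
  qed
  finally have Z: "?Z \<in> events" .
  have "mean n ?f = 1 - mean n (\<lambda>x. 1 - ?f x)"
    by (simp add: mean_compl[OF bf])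
  also have "mean n (\<lambda>x. 1 - ?f x) = (\<integral>x. indicator ?Z x \<partial>cube n)"
    unfolding mean_def
    by (rule Bochner_Integration.integral_cong) (auto simp: tribes_def indicator_def)
  also have "\<dots> = prob ?Z"
    using Z by (simp add: sets.Int_space_eq1)
  also have "\<dots> = (\<Prod>j<n div m. 1 - q ^ card (block m j))"
  proof (rule prob_no_block_le[OF _ _ _ disjoint_blocks])
    show "{..<n div m} \<noteq> {}"
      using assms(1,2) by (simp add: lessThan_empty_iff div_eq_0_iff)
  qed (use assms block_subset in auto)
  finally show ?thesis by (simp add: card_block)
qed

text \<open>A coordinate outside all blocks never has a non-constant fiber, and one inside a block has
  one only if the \<open>m - 1\<close> other members of its block are at most \<open>q\<close>.\<close>

lemma fibers_block_tribes:
  assumes "1 \<le> m" "0 \<le> q" "q \<le> 1"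
  shows "\<exists>B \<in> sets (cube n). measure (cube n) B \<le> q ^ (m - 1) \<and>
    (\<forall>x. x \<in> space (cube n) \<longrightarrow> fiber_mean (block_tribes n m q) k x \<in> {0, 1} \<or>
      fiber_mean (block_tribes n m q) k x = q \<and> x \<in> B)"
proof (cases "\<exists>j<n div m. k \<in> block m j")
  case True
  then obtain j where j: "j < n div m" "k \<in> block m j" by blast
  let ?S = "block m j - {k}"
  let ?B = "{x \<in> space (cube n). \<forall>i\<in>?S. x i \<le> q}"
  have sub: "?S \<subseteq> {1..n}" using block_subset[OF j(1)] by blast
  have "?B \<in> sets (cube n)"
    unfolding cube_def by (rule sets_all_coordinates_le[OF _ sub]) (simp add: block_def)
  moreover have "measure (cube n) ?B = q ^ (m - 1)"
    unfolding prob_all_coordinates_le[OF sub assms(2,3)] using j(2) by (simp add: card_block)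
  moreover have "j' = j" if "k \<in> block m j'" for j'
    using block_unique[OF j(2)] block_unique[OF that] by simp
  ultimately show ?thesis
    using fiber_mean_tribes[OF assms(2,3), of "{..<n div m}" "block m" k]
    by (intro bexI[of _ ?B]) (fastforce | simp)+
next
  case False
  then show ?thesis
    using fiber_mean_tribes[OF assms(2,3), of "{..<n div m}" "block m" k] assms
    by (intro bexI[of _ "{}"]) (fastforce | simp)+
qed

section \<open>Choice of the tribe size\<close>

text \<open>The second summand of the entropy is at most \<open>q / ln 2\<close>, because \<open>ln\<close> has slope at most
  \<open>1 / (1 - q)\<close> on the interval from \<open>1 - q\<close> to \<open>1\<close>; this is at most twice the first summand, because
  \<open>ln 2 \<ge> 1 / 2\<close> and \<open>log 2 (1 / q) \<ge> 1\<close>.\<close>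

lemma Ent_le:
  assumes "0 < q" "q \<le> 1 / 2"
  shows "Ent q \<le> 3 * q * log 2 (1 / q)"
proof -
  have L: "log 2 (1 / q) \<ge> 1"
    using assms by (subst le_log_iff) (auto simp: field_simps)
  have l2: "ln (2::real) \<ge> 1 / 2"
    using ln2_ge_two_thirds by simp
  have "ln (1 / (1 - q)) \<le> 1 / (1 - q) - 1"
    using assms by (intro ln_le_minus_one) auto
  then have "(1 - q) * - ln (1 - q) \<le> (1 - q) * (1 / (1 - q) - 1)"
    using assms by (intro mult_left_mono) (auto simp: ln_div)
  also have "\<dots> = q" using assms by (simp add: field_simps)
  finally have "((1 - q) * - ln (1 - q)) / ln 2 \<le> q / ln 2"
    by (rule divide_right_mono) simp
  then have "(1 - q) * - log 2 (1 - q) \<le> q / ln 2"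
    by (simp add: log_def)
  also have "\<dots> \<le> 2 * q"
    using l2 assms by (simp add: field_simps)
  also have "\<dots> \<le> 2 * q * log 2 (1 / q)"
    using L assms by simp
  finally show ?thesis
    using assms by (simp add: Ent_def log_divide)
qed

text \<open>The least \<open>m\<close> with \<open>q ^ m \<le> m / (2 * n)\<close> works: minimality bounds \<open>q ^ (m - 1)\<close> from below,
  which both keeps \<open>q ^ m\<close> within the factor \<open>q / 2\<close> of \<open>m / (2 * n)\<close> and makes
  \<open>m\<close> of order \<open>log n / log (1 / q)\<close>.\<close>

lemma tribe_size:
  fixes q :: real
  assumes "0 < q" "q \<le> 1 / 2"
  shows "\<forall>\<^sub>F n in sequentially. \<exists>m. 2 \<le> m \<and> 2 * m \<le> n \<and>
    q ^ m \<le> real m / (2 * real n) \<and> real (m - 1) / (2 * real n) \<le> q ^ (m - 1) \<and>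
    real m * log 2 (1 / q) \<le> 4 * log 2 (real n)"
proof -
  have e1: "\<forall>\<^sub>F n in sequentially. 1 / (2 * real n) < q"
    using assms(1) by real_asymp
  have e2: "\<forall>\<^sub>F n in sequentially. 8 * log 2 (real n) \<le> real n" by real_asymp
  show ?thesis
    using e1 e2 eventually_ge_at_top[of 2]
  proof eventually_elim
    case (elim n)
    let ?P = "\<lambda>m. q ^ m \<le> real m / (2 * real n)"
    have L: "log 2 (1 / q) \<ge> 1"
      using assms by (subst le_log_iff) (auto simp: field_simps)
    have "q ^ n \<le> q ^ 1"
      using assms elim by (intro power_decreasing) auto
    then have "?P n" using assms elim by simp
    define m where "m = (LEAST m. ?P m)"
    have m: "?P m" unfolding m_def using \<open>?P n\<close> by (rule LeastI)
    have "m \<noteq> 0" using m by (intro notI) simp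
    moreover have "m \<noteq> 1" using m elim by (intro notI) simp
    ultimately have m2: "2 \<le> m" by simp
    have "\<not> ?P (m - 1)"
      using m2 unfolding m_def by (intro not_less_Least) simp
    then have lower: "(real m - 1) / (2 * real n) < q ^ (m - 1)"
      using m2 by (simp add: of_nat_diff)
    have "1 / (2 * real n) \<le> (real m - 1) / (2 * real n)"
      using m2 by (intro divide_right_mono) auto
    then have "1 / (2 * real n) < q ^ (m - 1)" using lower by linarith
    then have "(1 / q) ^ (m - 1) < 2 * real n"
      using assms elim by (simp add: field_simps)
    then have "log 2 ((1 / q) ^ (m - 1)) < log 2 (2 * real n)"
      using assms elim by (subst log_less_cancel_iff) auto
    then have "(real m - 1) * log 2 (1 / q) < 1 + log 2 n"
      using assms elim m2 by (simp add: log_nat_power log_mult of_nat_diff)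
    moreover have "log 2 n \<ge> 1"
      using elim by (subst le_log_iff) auto
    moreover have "real m * log 2 (1 / q) \<le> 2 * ((real m - 1) * log 2 (1 / q))"
    proof -
      have "real m * log 2 (1 / q) \<le> (2 * (real m - 1)) * log 2 (1 / q)"
        using m2 L by (intro mult_right_mono) auto
      then show ?thesis by (simp add: algebra_simps)
    qed
    ultimately have upper: "real m * log 2 (1 / q) \<le> 4 * log 2 n" by linarith
    have "real m * 1 \<le> real m * log 2 (1 / q)"
      using L by (intro mult_left_mono) auto
    then have "2 * m \<le> n" using upper elim by simp
    then show ?case using m m2 lower upper by (intro exI[of _ m]) (auto simp: of_nat_diff)
  qed
qed

text \<open>By Bernoulli's inequality the mean is at most the expected number \<open>N * q ^ m\<close> of satisfied
  tribes, hence at most \<open>1 / 2\<close>. In the other direction that number is at least \<open>q / 8\<close>, and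
  \<open>(1 - p) ^ N \<le> exp (- p * N)\<close>.\<close>

lemma mean_block_tribes_bounds:
  fixes q :: real
  assumes q: "0 < q" "q \<le> 1 / 2" and m: "2 \<le> m" "2 * m \<le> n"
    and upper: "q ^ m \<le> real m / (2 * real n)"
    and lower: "real (m - 1) / (2 * real n) \<le> q ^ (m - 1)"
  shows "mean n (block_tribes n m q) \<in> {1 - exp (- q / 8)..1 / 2}"
proof -
  let ?N = "n div m" and ?p = "q ^ m"
  have mean: "mean n (block_tribes n m q) = 1 - (1 - ?p) ^ ?N"
    using m q by (intro mean_block_tribes) auto
  have p: "0 \<le> ?p" "?p \<le> 1"
    using q by (auto intro: power_le_one)
  have Nm: "real ?N * real m \<le> n"
    by (metis div_times_less_eq_dividend of_nat_le_iff of_nat_mult)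
  have "real ?N * ?p \<le> real ?N * (real m / (2 * real n))"
    using upper by (intro mult_left_mono) auto
  also have "\<dots> \<le> 1 / 2"
    using Nm m by (simp add: field_simps)
  finally have "real ?N * ?p \<le> 1 / 2" .
  moreover have "1 + real ?N * (- ?p) \<le> (1 + - ?p) ^ ?N"
    using p by (intro Bernoulli_inequality) auto
  ultimately have "mean n (block_tribes n m q) \<le> 1 / 2"
    unfolding mean by simp
  have "n < (?N + 1) * m"
    using m by (simp add: dividend_less_div_times)
  moreover have "1 \<le> ?N" using m by (simp add: Suc_le_eq div_greater_zero_iff)
  then have "(?N + 1) * m \<le> (2 * ?N) * m"
    by (intro mult_le_mono1) simp
  ultimately have "n \<le> 2 * ?N * m" by linarith
  then have N: "real n \<le> 2 * (real ?N * real m)"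
    by (metis mult.assoc of_nat_le_iff of_nat_mult of_nat_numeral)
  have "q / 8 \<le> q * (real (m - 1) / (2 * real n)) * real ?N"
  proof -
    have "real n \<le> 4 * (real (m - 1) * real ?N)"
    proof -
      have "real m * real ?N \<le> (2 * real (m - 1)) * real ?N"
        using m by (intro mult_right_mono) auto
      then show ?thesis using N by (simp add: mult.commute)
    qed
    then have "1 / 8 \<le> real (m - 1) / (2 * real n) * real ?N"
      using m by (simp add: divide_simps)
    then show ?thesis
      using q mult_left_mono[of "1 / 8" "real (m - 1) / (2 * real n) * real ?N" q]
      by (simp only: mult.assoc) simp
  qed
  also have "\<dots> \<le> q * q ^ (m - 1) * real ?N"
    using lower q by (intro mult_right_mono mult_left_mono) auto
  also have "q * q ^ (m - 1) = ?p"
    using m by (metis power_minus_mult mult.commute pos2 less_le_trans)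
  finally have Np: "q / 8 \<le> ?p * real ?N" .
  have "(1 - ?p) ^ ?N \<le> exp (- ?p) ^ ?N"
    using p exp_ge_add_one_self[of "- ?p"] by (intro power_mono) auto
  also have "\<dots> = exp (- (?p * real ?N))"
    by (simp add: exp_of_nat_mult[symmetric] mult.commute)
  also have "\<dots> \<le> exp (- q / 8)" using Np by simp
  finally show ?thesis
    using \<open>mean n (block_tribes n m q) \<le> 1 / 2\<close> unfolding mean by simp
qed

lemma balanced_tribes:
  fixes q :: real
  assumes q: "0 < q" "q \<le> 1 / 2"
  shows "\<exists>f. \<forall>\<^sub>F n in sequentially. boolean_on_cube n (f n) \<and>
    mean n (f n) \<in> {1 - exp (- q / 8)..1 / 2} \<and>
    (\<forall>k. \<exists>B \<in> sets (cube n). measure (cube n) B \<le> 2 * log 2 n / (n * q * log 2 (1 / q)) \<and>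
      (\<forall>x. x \<in> space (cube n) \<longrightarrow> fiber_mean (f n) k x \<in> {0, 1} \<or>
        fiber_mean (f n) k x = q \<and> x \<in> B))"
proof -
  let ?P = "\<lambda>n m. 2 \<le> m \<and> 2 * m \<le> n \<and> q ^ m \<le> real m / (2 * real n) \<and>
    real (m - 1) / (2 * real n) \<le> q ^ (m - 1) \<and> real m * log 2 (1 / q) \<le> 4 * log 2 (real n)"
  define M where "M n = (SOME m. ?P n m)" for n
  have L: "log 2 (1 / q) > 0" using q by simp
  have "\<forall>\<^sub>F n in sequentially. ?P n (M n)"
    using tribe_size[OF q] unfolding M_def by eventually_elim (rule someI_ex)
  then have "\<forall>\<^sub>F n in sequentially. boolean_on_cube n (block_tribes n (M n) q) \<and>
    mean n (block_tribes n (M n) q) \<in> {1 - exp (- q / 8)..1 / 2} \<and>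
    (\<forall>k. \<exists>B \<in> sets (cube n). measure (cube n) B \<le> 2 * log 2 n / (n * q * log 2 (1 / q)) \<and>
      (\<forall>x. x \<in> space (cube n) \<longrightarrow> fiber_mean (block_tribes n (M n) q) k x \<in> {0, 1} \<or>
        fiber_mean (block_tribes n (M n) q) k x = q \<and> x \<in> B))"
  proof eventually_elim
    case (elim n)
    let ?m = "M n"
    have n: "n > 0" using elim by linarith
    have "q ^ (?m - 1) = q ^ ?m / q"
      using q elim by (simp add: power_diff)
    also have "\<dots> \<le> (?m / (2 * n)) / q"
      using q elim by (intro divide_right_mono) auto
    also have "\<dots> \<le> ((4 * log 2 n / log 2 (1 / q)) / (2 * n)) / q"
      using q L elim by (intro divide_right_mono) (auto simp: pos_le_divide_eq)
    also have "\<dots> = 2 * log 2 n / (n * q * log 2 (1 / q))"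
      by simp
    finally have small: "q ^ (?m - 1) \<le> 2 * log 2 n / (n * q * log 2 (1 / q))" .
    have fibers: "\<exists>B \<in> sets (cube n). measure (cube n) B \<le> q ^ (?m - 1) \<and>
      (\<forall>x. x \<in> space (cube n) \<longrightarrow> fiber_mean (block_tribes n ?m q) k x \<in> {0, 1} \<or>
        fiber_mean (block_tribes n ?m q) k x = q \<and> x \<in> B)" for k
      using elim q by (intro fibers_block_tribes) auto
    have "\<exists>B \<in> sets (cube n). measure (cube n) B \<le> 2 * log 2 n / (n * q * log 2 (1 / q)) \<and>
      (\<forall>x. x \<in> space (cube n) \<longrightarrow> fiber_mean (block_tribes n ?m q) k x \<in> {0, 1} \<or>
        fiber_mean (block_tribes n ?m q) k x = q \<and> x \<in> B)" for k
      using fibers[of k] small order_trans by blast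
    moreover have "boolean_on_cube n (block_tribes n ?m q)"
      using block_subset by (intro boolean_tribes) auto
    moreover have "mean n (block_tribes n ?m q) \<in> {1 - exp (- q / 8)..1 / 2}"
      using elim by (intro mean_block_tribes_bounds q) auto
    ultimately show ?case by blast
  qed
  then show ?thesis by (intro exI[of _ "\<lambda>n. block_tribes n (M n) q"])
qed

lemma bigtheta_one_if_bounded:
  fixes g :: "nat \<Rightarrow> real"
  assumes "0 < a" "\<forall>\<^sub>F n in sequentially. g n \<in> {a..b}"
  shows "g \<in> \<Theta>(\<lambda>_. 1)"
proof (rule bigthetaI'[of a "max b 1"])
  show "\<forall>\<^sub>F n in sequentially. a * norm (1::real) \<le> norm (g n) \<and> norm (g n) \<le> max b 1 * norm (1::real)"
    using assms(2) by eventually_elim (use assms(1) in auto)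
qed (use assms in auto)

text \<open>With probability at most \<open>2 log n / (n q log (1 / q))\<close> the fiber is non-constant, and then
  it contributes \<open>h r \<le> \<epsilon> Ent q \<le> 3 \<epsilon> q log (1 / q)\<close>; the factors \<open>q log (1 / q)\<close> cancel.\<close>

lemma h_influence_le_log_div:
  assumes f: "boolean_on_cube n f" and k: "k \<in> {1..n}" and q: "0 < q" "q \<le> 1 / 2"
    and B: "B \<in> sets (cube n)" "measure (cube n) B \<le> 2 * log 2 n / (n * q * log 2 (1 / q))"
    and fib: "\<And>x. x \<in> space (cube n) \<Longrightarrow>
      fiber_mean f k x \<in> {0, 1} \<or> fiber_mean f k x = r \<and> x \<in> B"
    and h: "h 0 = 0" "h 1 = 0" "0 \<le> h r" and "h r \<le> \<epsilon> * Ent q" "0 < \<epsilon>"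
  shows "h_influence_defined h n f k \<and> h_influence h n f k \<le> 6 * \<epsilon> * (log 2 n / n)"
proof -
  let ?p = "2 * log 2 n / (n * q * log 2 (1 / q))"
  note I = h_influence_le[OF f k B fib h]
  have L: "log 2 (1 / q) > 0" using q by simp
  have "0 \<le> ?p"
    using B(2) measure_nonneg order_trans by blast
  have "h r \<le> \<epsilon> * (3 * q * log 2 (1 / q))"
    using assms Ent_le[OF q] by (meson mult_left_mono order_trans less_imp_le)
  then have "h r * ?p \<le> \<epsilon> * (3 * q * log 2 (1 / q)) * ?p"
    using \<open>0 \<le> ?p\<close> by (rule mult_right_mono)
  also have "\<dots> = 6 * \<epsilon> * (log 2 n / n)"
    using q L less_imp_neq[OF L] by (simp add: divide_simps)
  finally show ?thesis using I by force
qed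

theorem proposition1:
  "\<exists>c::real. 0 < c \<and>
    (\<forall>(h :: real \<Rightarrow> real) (\<epsilon> :: real).
      h \<in> {0..1} \<rightarrow> {0..1} \<longrightarrow> h 0 = 0 \<longrightarrow> h 1 = 0 \<longrightarrow> 0 < \<epsilon> \<longrightarrow>
      (\<exists>q. 0 < q \<and> q < 1 \<and> h q \<le> \<epsilon> * Ent q) \<longrightarrow>
      (\<exists>f :: nat \<Rightarrow> (nat \<Rightarrow> real) \<Rightarrow> real.
        (\<lambda>n. mean n (f n)) \<in> \<Theta>(\<lambda>_. 1) \<and>
        (\<lambda>n. 1 - mean n (f n)) \<in> \<Theta>(\<lambda>_. 1) \<and>
        (\<forall>\<^sub>F n in sequentially.
          boolean_on_cube n (f n) \<and>
          (\<forall>k\<in>{1..n}.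
            h_influence_defined h n (f n) k \<and>
            h_influence h n (f n) k \<le> c * \<epsilon> * (log 2 (real n) / real n)))))"
proof (intro exI[of _ 6] conjI allI impI)
  fix h :: "real \<Rightarrow> real" and \<epsilon> :: real
  assume h: "h \<in> {0..1} \<rightarrow> {0..1}" "h 0 = 0" "h 1 = 0" and eps: "0 < \<epsilon>"
    and "\<exists>q. 0 < q \<and> q < 1 \<and> h q \<le> \<epsilon> * Ent q"
  then obtain r where r: "0 < r" "r < 1" "h r \<le> \<epsilon> * Ent r" by blast
  have hr: "0 \<le> h r" using h(1) r(1,2) by (auto simp: Pi_iff)
  define q where "q = min r (1 - r)"
  have q: "0 < q" "q \<le> 1 / 2" using r(1,2) by (simp_all add: q_def min_def)
  have "Ent q = Ent r" by (simp add: q_def min_def Ent_def)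
  then have hq: "h r \<le> \<epsilon> * Ent q" using r(3) by simp
  let ?a = "1 - exp (- q / 8)"
  have a: "0 < ?a" using q by simp
  obtain t where t: "\<forall>\<^sub>F n in sequentially. boolean_on_cube n (t n) \<and>
    mean n (t n) \<in> {?a..1 / 2} \<and>
    (\<forall>k. \<exists>B \<in> sets (cube n). measure (cube n) B \<le> 2 * log 2 n / (n * q * log 2 (1 / q)) \<and>
      (\<forall>x. x \<in> space (cube n) \<longrightarrow> fiber_mean (t n) k x \<in> {0, 1} \<or>
        fiber_mean (t n) k x = q \<and> x \<in> B))"
    using balanced_tribes[OF q] by blast
  \<comment> \<open>If \<open>r > 1/2\<close>, the non-constant fibers of the complement have mean \<open>1 - q = r\<close>.\<close>
  define f where "f n = (if r \<le> 1 / 2 then t n else (\<lambda>x. 1 - t n x))" for n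
  have main: "\<forall>\<^sub>F n in sequentially. mean n (f n) \<in> {min ?a (1 / 2)..max (1 / 2) (1 - ?a)} \<and>
    boolean_on_cube n (f n) \<and> (\<forall>k\<in>{1..n}. h_influence_defined h n (f n) k \<and>
      h_influence h n (f n) k \<le> 6 * \<epsilon> * (log 2 (real n) / real n))"
    using t
  proof eventually_elim
    case (elim n)
    have bt: "boolean_on_cube n (t n)" and mt: "mean n (t n) \<in> {?a..1 / 2}" using elim by auto
    have bf: "boolean_on_cube n (f n)"
      using bt boolean_compl[OF bt] by (simp add: f_def)
    have "mean n (f n) \<in> {min ?a (1 / 2)..max (1 / 2) (1 - ?a)}"
      using mt mean_compl[OF bt] by (auto simp: f_def)
    moreover have "h_influence_defined h n (f n) k \<and>
      h_influence h n (f n) k \<le> 6 * \<epsilon> * (log 2 (real n) / real n)" if k: "k \<in> {1..n}" for k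
    proof -
      obtain B where B: "B \<in> sets (cube n)"
          "measure (cube n) B \<le> 2 * log 2 n / (n * q * log 2 (1 / q))"
        and fib: "\<And>x. x \<in> space (cube n) \<Longrightarrow> fiber_mean (t n) k x \<in> {0, 1} \<or>
          fiber_mean (t n) k x = q \<and> x \<in> B"
        using elim by blast
      have "fiber_mean (f n) k x \<in> {0, 1} \<or> fiber_mean (f n) k x = r \<and> x \<in> B"
        if x: "x \<in> space (cube n)" for x
        using fib[OF x] fiber_mean_compl[OF bt k x] by (auto simp: f_def q_def)
      then show ?thesis
        using h_influence_le_log_div[OF bf k q B _ h(2,3) hr hq eps] by blast
    qed
    ultimately show ?case using bf by blast
  qed
  have mean: "\<forall>\<^sub>F n in sequentially. mean n (f n) \<in> {min ?a (1 / 2)..max (1 / 2) (1 - ?a)}"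
    using main by eventually_elim blast
  then have mean': "\<forall>\<^sub>F n in sequentially. 1 - mean n (f n) \<in> {min ?a (1 / 2)..1 - min ?a (1 / 2)}"
    by eventually_elim auto
  have "(\<lambda>n. mean n (f n)) \<in> \<Theta>(\<lambda>_. 1)" "(\<lambda>n. 1 - mean n (f n)) \<in> \<Theta>(\<lambda>_. 1)"
    using bigtheta_one_if_bounded[OF _ mean] bigtheta_one_if_bounded[OF _ mean'] a by auto
  moreover have "\<forall>\<^sub>F n in sequentially. boolean_on_cube n (f n) \<and>
      (\<forall>k\<in>{1..n}. h_influence_defined h n (f n) k \<and>
        h_influence h n (f n) k \<le> 6 * \<epsilon> * (log 2 (real n) / real n))"
    using main by eventually_elim blast
  ultimately show "\<exists>f. (\<lambda>n. mean n (f n)) \<in> \<Theta>(\<lambda>_. 1) \<and> (\<lambda>n. 1 - mean n (f n)) \<in> \<Theta>(\<lambda>_. 1) \<and>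
      (\<forall>\<^sub>F n in sequentially. boolean_on_cube n (f n) \<and>
        (\<forall>k\<in>{1..n}. h_influence_defined h n (f n) k \<and>
          h_influence h n (f n) k \<le> 6 * \<epsilon> * (log 2 (real n) / real n)))"
    by blast
qed simp

end
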